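(* For $i\ge0$ let $S_{(k+i,k)}=\sum_{k\ge0}s_{(k+i,k)}\,t^k$. Then $$t\cdot\left(S_{(k,k)}\,S_{(k+2,k)}-S_{(k+1,k)}^2\right)+S_{(k,k)}^2=\sum_{0\le b\le a}s_{(a,a,b,b)}\,t^{a+b},$$ where the sum on the right is over all pairs of integers $0\le b\le a$.
   Context: $s_\lambda$ is the Schur function (in infinitely many variables) indexed by the partition $\lambda$, with $s_\varnothing=1$; trailing zero parts are ignored. In the notation $S_{(k+i,k)}$ the letter $k$ is the (bound) summation index. The identity is in the ring of formal power series in $t$ with coefficients in the ring of symmetric functions over $\mathbb Q$. *)

theory Defs
  imports "HOL-Library.Multiset" "HOL-Computational_Algebra.Formal_Power_Series"
begin

section \<open>Formal power series in infinitely many variables\<close>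

text \<open>
  The ring of symmetric functions over \<open>\<rat>\<close> consists of formal power series in countably many
  commuting variables \<open>x\<^sub>0, x\<^sub>1, \<dots>\<close> that are symmetric and of bounded degree. It is a subring of the
  ring of all formal power series in these variables, which is the type defined here;
  identities between symmetric functions are stated in this larger ring.

  A monomial is a finite multiset of variable indices: \<open>m\<close> stands for the product of the \<open>x\<^sub>i\<close>,
  \<open>i \<in># m\<close>, so that the exponent of \<open>x\<^sub>i\<close> is \<open>count m i\<close> and multiplication of monomials is \<open>+\<close>.
\<close>

typedef 'a inf_fps = "UNIV :: (nat multiset \<Rightarrow> 'a) set"
  morphisms inf_coeff Abs_inf_fps ..

lemma inf_coeff_Abs [simp]: "inf_coeff (Abs_inf_fps f) = f"
  by (simp add: Abs_inf_fps_inverse)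

lemma inf_fps_eqI: "(\<And>m. inf_coeff f m = inf_coeff g m) \<Longrightarrow> f = g"
  by (metis ext inf_coeff_inject)

lemma finite_mset_antidiagonal [simp]:
  "finite {(u, v). u + v = (m :: 'b multiset)}"
proof -
  have fin: "finite {u. u \<subseteq># m}"
  proof (induction m)
    case empty
    show ?case by simp
  next
    case (add x m)
    have "u \<in> {u. u \<subseteq># m} \<union> add_mset x ` {u. u \<subseteq># m}" if "u \<subseteq># add_mset x m" for u
    proof (cases "x \<in># u")
      case True
      then obtain w where "u = add_mset x w" by (metis insert_DiffM)
      with that show ?thesis by auto
    next
      case False
      with that show ?thesis
        by (metis (no_types, lifting) UnI1 diff_single_trivial mem_Collect_eq
            subset_eq_diff_conv add_mset_add_single)
    qed
    then have "{u. u \<subseteq># add_mset x m} \<subseteq> {u. u \<subseteq># m} \<union> add_mset x ` {u. u \<subseteq># m}" by blast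
    with add.IH show ?case by (meson finite_UnI finite_imageI finite_subset)
  qed
  have "{(u, v). u + v = m} \<subseteq> {u. u \<subseteq># m} \<times> {u. u \<subseteq># m}"
    by auto
  with fin show ?thesis by (meson finite_SigmaI finite_subset)
qed

instantiation inf_fps :: (comm_ring_1) comm_ring_1
begin

definition "0 = Abs_inf_fps (\<lambda>_. 0)"
definition "1 = Abs_inf_fps (\<lambda>m. if m = {#} then 1 else 0)"
definition "f + g = Abs_inf_fps (\<lambda>m. inf_coeff f m + inf_coeff g m)"
definition "- f = Abs_inf_fps (\<lambda>m. - inf_coeff f m)"
definition "f - g = Abs_inf_fps (\<lambda>m. inf_coeff f m - inf_coeff g m)"
definition "f * g = Abs_inf_fps (\<lambda>m. \<Sum>(u, v) | u + v = m. inf_coeff f u * inf_coeff g v)"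

lemma inf_coeff_0 [simp]: "inf_coeff 0 m = 0"
  and inf_coeff_1: "inf_coeff 1 m = (if m = {#} then 1 else 0)"
  and inf_coeff_add [simp]: "inf_coeff (f + g) m = inf_coeff f m + inf_coeff g m"
  and inf_coeff_uminus [simp]: "inf_coeff (- f) m = - inf_coeff f m"
  and inf_coeff_diff [simp]: "inf_coeff (f - g) m = inf_coeff f m - inf_coeff g m"
  and inf_coeff_mult: "inf_coeff (f * g) m = (\<Sum>(u, v) | u + v = m. inf_coeff f u * inf_coeff g v)"
  by (simp_all add: zero_inf_fps_def one_inf_fps_def plus_inf_fps_def uminus_inf_fps_def
      minus_inf_fps_def times_inf_fps_def)

instance
proof
  fix f g h :: "'a inf_fps"
  show "f * g * h = f * (g * h)"
  proof (rule inf_fps_eqI)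
    fix m
    let ?F = "inf_coeff f" and ?G = "inf_coeff g" and ?H = "inf_coeff h"
    let ?A = "\<lambda>w :: nat multiset. {(u, v). u + v = w}"
    have "inf_coeff (f * g * h) m =
        (\<Sum>p\<in>?A m. \<Sum>q\<in>?A (fst p). ?F (fst q) * ?G (snd q) * ?H (snd p))"
      by (simp add: inf_coeff_mult sum_distrib_right case_prod_beta)
    also have "\<dots> = (\<Sum>(p, q) \<in> Sigma (?A m) (\<lambda>p. ?A (fst p)).
        ?F (fst q) * ?G (snd q) * ?H (snd p))"
      using finite_mset_antidiagonal by (subst sum.Sigma) (auto simp: case_prod_beta)
    also have "\<dots> = (\<Sum>(p, q) \<in> Sigma (?A m) (\<lambda>p. ?A (snd p)).
        ?F (fst p) * (?G (fst q) * ?H (snd q)))"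
      by (rule sum.reindex_bij_witness
          [where i = "\<lambda>(p, q). ((fst p + fst q, snd q), (fst p, fst q))"
            and j = "\<lambda>(p, q). ((fst q, snd q + snd p), (snd q, snd p))"])
        (auto simp: mult.assoc add.assoc)
    also have "\<dots> =
        (\<Sum>p\<in>?A m. \<Sum>q\<in>?A (snd p). ?F (fst p) * (?G (fst q) * ?H (snd q)))"
      using finite_mset_antidiagonal by (subst sum.Sigma) (auto simp: case_prod_beta)
    also have "\<dots> = inf_coeff (f * (g * h)) m"
      by (simp add: inf_coeff_mult sum_distrib_left case_prod_beta)
    finally show "inf_coeff (f * g * h) m = inf_coeff (f * (g * h)) m" .
  qed
  show "f * g = g * f"
  proof (rule inf_fps_eqI)
    fix m
    show "inf_coeff (f * g) m = inf_coeff (g * f) m"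
      unfolding inf_coeff_mult
      by (rule sum.reindex_bij_witness[where i = prod.swap and j = prod.swap])
        (auto simp: add.commute mult.commute)
  qed
  show "1 * f = f"
  proof (rule inf_fps_eqI)
    fix m
    have "inf_coeff (1 * f) m = (\<Sum>(u, v)\<in>{({#}, m)}. inf_coeff 1 u * inf_coeff f v)"
      unfolding inf_coeff_mult
      by (intro sum.mono_neutral_right finite_mset_antidiagonal)
        (auto simp: inf_coeff_1 split: if_splits)
    then show "inf_coeff (1 * f) m = inf_coeff f m" by (simp add: inf_coeff_1)
  qed
  show "(f + g) * h = f * h + g * h"
    by (rule inf_fps_eqI) (simp add: inf_coeff_mult case_prod_beta distrib_right sum.distrib)
  have "inf_coeff 0 {#} \<noteq> inf_coeff (1 :: 'a inf_fps) {#}"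
    by (simp add: inf_coeff_1)
  then show "(0 :: 'a inf_fps) \<noteq> 1" by metis
qed (auto intro!: inf_fps_eqI simp: algebra_simps)

end


section \<open>Schur functions\<close>

text \<open>
  A tableau is the list of its rows, from top to bottom (English notation). The second argument
  is the shape, a partition written as a weakly decreasing list whose last entries may be 0.
\<close>

definition semistandard :: "nat list list \<Rightarrow> nat list \<Rightarrow> bool" where
  "semistandard T \<mu> \<longleftrightarrow>
     map length T = \<mu> \<and>
     (\<forall>row \<in> set T. sorted row) \<and>
     (\<forall>i j. Suc i < length T \<longrightarrow> j < length (T ! Suc i) \<longrightarrow> T ! i ! j < T ! Suc i ! j)"

text \<open>
  The monomial of a tableau is the multiset of its entries, so this is the usual generating
  function of semistandard tableaux. It is meaningful only if \<open>\<mu>\<close> is weakly decreasing.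
\<close>

definition schur :: "nat list \<Rightarrow> rat inf_fps" where
  "schur \<mu> = Abs_inf_fps (\<lambda>m. of_nat (card {T. semistandard T \<mu> \<and> mset (concat T) = m}))"

lemma finite_semistandard: "finite {T. semistandard T \<mu> \<and> mset (concat T) = m}"
proof (rule finite_subset)
  let ?R = "{row. set row \<subseteq> set_mset m \<and> length row \<le> sum_list \<mu>}"
  show "finite {T. set T \<subseteq> ?R \<and> length T = length \<mu>}"
    by (intro finite_lists_length_eq finite_lists_length_le) simp
  show "{T. semistandard T \<mu> \<and> mset (concat T) = m} \<subseteq> {T. set T \<subseteq> ?R \<and> length T = length \<mu>}"
    by (auto simp: semistandard_def intro!: member_le_sum_list)
qed

lemma schur_Nil: "schur [] = 1"
proof (rule inf_fps_eqI)
  fix m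
  have "{T. semistandard T [] \<and> mset (concat T) = m} = (if m = {#} then {[]} else {})"
    by (auto simp: semistandard_def)
  then show "inf_coeff (schur []) m = inf_coeff 1 m"
    by (simp add: schur_def inf_coeff_1)
qed

lemma schur_trailing_zero: "schur (\<mu> @ [0]) = schur \<mu>"
proof (rule inf_fps_eqI)
  fix m
  have "bij_betw (\<lambda>T. T @ [[]]) {T. semistandard T \<mu> \<and> mset (concat T) = m}
      {T. semistandard T (\<mu> @ [0]) \<and> mset (concat T) = m}"
  proof (rule bij_betwI[where g = butlast])
    show "(\<lambda>T. T @ [[]]) \<in> {T. semistandard T \<mu> \<and> mset (concat T) = m} \<rightarrow>
        {T. semistandard T (\<mu> @ [0]) \<and> mset (concat T) = m}"
      by (auto simp: semistandard_def nth_append)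
    have *: "\<exists>T'. T = T' @ [[]] \<and> semistandard T' \<mu>" if "semistandard T (\<mu> @ [0])" for T
    proof -
      from that have "map length T = \<mu> @ [0]" by (simp add: semistandard_def)
      then obtain T' where T': "T = T' @ [[]]" "map length T' = \<mu>"
        by (auto simp: map_eq_append_conv)
      have "T' ! i ! j < T' ! Suc i ! j" if "Suc i < length T'" "j < length (T' ! Suc i)" for i j
        using \<open>semistandard T (\<mu> @ [0])\<close> that
        unfolding semistandard_def T'(1)
        by (metis Suc_lessD butlast_snoc length_append_singleton less_SucI nth_butlast)
      with T' that show ?thesis by (auto simp: semistandard_def)
    qed
    show "butlast \<in> {T. semistandard T (\<mu> @ [0]) \<and> mset (concat T) = m} \<rightarrow>
        {T. semistandard T \<mu> \<and> mset (concat T) = m}"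
      using * by fastforce
    show "butlast (T @ [[]]) = T" for T :: "nat list list" by simp
    show "butlast T @ [[]] = T"
      if "T \<in> {T. semistandard T (\<mu> @ [0]) \<and> mset (concat T) = m}" for T
      using that * by fastforce
  qed
  then show "inf_coeff (schur (\<mu> @ [0])) m = inf_coeff (schur \<mu>) m"
    by (simp add: schur_def bij_betw_same_card)
qed

definition two_row_series :: "nat \<Rightarrow> rat inf_fps fps" where
  "two_row_series i = Abs_fps (\<lambda>k. schur [k + i, k])"

end

theory Submission
  imports Defs "Jordan_Normal_Form.Determinant"
begin

text \<open>
  Write \<open>A\<^sub>k\<close>, \<open>B\<^sub>k\<close>, \<open>C\<^sub>k\<close> for the Schur functions of shapes \<open>(k, k)\<close>, \<open>(k + 1, k)\<close>,
  \<open>(k + 2, k)\<close>. The coefficient of \<open>t\<^sup>n\<close> on the left is the sum over all \<open>a + b = n\<close> of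
  \<open>G(a, b) = A\<^sub>a A\<^sub>b - B\<^sub>a B\<^sub>b\<^sub>-\<^sub>1 + C\<^sub>a A\<^sub>b\<^sub>-\<^sub>1\<close>.
  By the Jacobi--Trudi formula the Schur function of \<open>(a, a, b, b)\<close> is a determinant \<open>D(a, b)\<close> of
  size 4 in the complete homogeneous functions, and the functions with two rows are minors of size
  2. Laplace expansion along the first two rows gives \<open>D(a, b) = G(a, b) + G(b - 2, a + 2)\<close>
  (\<open>det_jacobi_trudi_mat_four_rows\<close>).

  Summing over \<open>a \<ge> b\<close>, the first summand contributes the pairs with \<open>a - b \<ge> 0\<close> and
  the second the pairs with \<open>a - b \<le> -4\<close>. The remaining pairs have \<open>a - b \<in> {-1, -2, -3}\<close>, and
  on them \<open>G\<close> adds up to zero: the determinant \<open>D\<close> has two equal rows there, which is a quadratic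
  relation between minors (\<open>half_laplace_gap_two\<close>, \<open>half_laplace_gap_one_three\<close>). This is
  \<open>sum_half_laplace\<close>, a statement about an arbitrary function \<open>h\<close> that vanishes on negative
  integers.

  The Jacobi--Trudi formula is proved for finitely many variables, taken in any commutative ring, by
  induction on their number (\<open>schur_poly_eq_det_jacobi_trudi_mat\<close>). Removing the largest entry \<open>N\<close>
  from all tableaux expresses a Schur polynomial through those with one variable fewer. The
  determinant obeys the same recursion: subtracting from each row a multiple of the next one turns
  row \<open>i\<close> into a sum over the possible lengths of the \<open>i\<close>-th row after the removal, and the
  determinant is multilinear. The result passes to infinitely many variables because a power series
  is determined by its restrictions to the variables with index below \<open>N\<close>, for all \<open>N\<close>, and restriction
  is a ring homomorphism.
\<close>

section \<open>Schur polynomials and the branching rule\<close>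

definition tableaux :: "nat \<Rightarrow> nat list \<Rightarrow> nat list list set" where
  "tableaux N \<mu> = {T. semistandard T \<mu> \<and> set (concat T) \<subseteq> {..<N}}"

definition schur_poly :: "(nat \<Rightarrow> 'a::comm_ring_1) \<Rightarrow> nat \<Rightarrow> nat list \<Rightarrow> 'a" where
  "schur_poly x N \<mu> = (\<Sum>T\<in>tableaux N \<mu>. prod_list (map x (concat T)))"

text \<open>
  The least length that row \<open>i\<close> can have after the removal of all copies of the largest letter:
  columns increase strictly, so such a copy has no cell below it.
\<close>

definition row_floor :: "nat list \<Rightarrow> nat \<Rightarrow> nat" where
  "row_floor \<mu> i = (if Suc i < length \<mu> then \<mu> ! Suc i else 0)"

text \<open>The shapes obtained by removing a horizontal strip.\<close>

definition interlacing :: "nat list \<Rightarrow> nat list set" where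
  "interlacing \<mu> = {\<nu>. length \<nu> = length \<mu> \<and> (\<forall>i<length \<mu>. \<nu> ! i \<in> {row_floor \<mu> i..\<mu> ! i})}"

lemma finite_tableaux: "finite (tableaux N \<mu>)"
proof (rule finite_subset)
  let ?R = "{row. set row \<subseteq> {..<N} \<and> length row \<le> sum_list \<mu>}"
  show "finite {T. set T \<subseteq> ?R \<and> length T = length \<mu>}"
    by (intro finite_lists_length_eq finite_lists_length_le) simp
  show "tableaux N \<mu> \<subseteq> {T. set T \<subseteq> ?R \<and> length T = length \<mu>}"
    by (auto simp: tableaux_def semistandard_def intro!: member_le_sum_list)
qed

lemma finite_interlacing: "finite (interlacing \<mu>)"
proof (rule finite_subset)
  show "finite {\<nu>. set \<nu> \<subseteq> {..sum_list \<mu>} \<and> length \<nu> = length \<mu>}"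
    by (rule finite_lists_length_eq) simp
  have "\<nu> ! i \<le> sum_list \<mu>" if "\<nu> \<in> interlacing \<mu>" "i < length \<mu>" for \<nu> i
    using that elem_le_sum_list[of i \<mu>] by (force simp: interlacing_def)
  then show "interlacing \<mu> \<subseteq> {\<nu>. set \<nu> \<subseteq> {..sum_list \<mu>} \<and> length \<nu> = length \<mu>}"
    by (auto simp: interlacing_def in_set_conv_nth)
qed

lemma partition_nth_Suc:
  assumes "sorted_wrt (\<ge>) \<mu>" "Suc i < length \<mu>"
  shows "\<mu> ! Suc i \<le> \<mu> ! i"
  using sorted_wrt_nth_less[OF assms(1), of i "Suc i"] assms(2) by simp

lemma row_floor_le:
  assumes "sorted_wrt (\<ge>) \<mu>" "i < length \<mu>"
  shows "row_floor \<mu> i \<le> \<mu> ! i"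
  using partition_nth_Suc[OF assms(1)] by (simp add: row_floor_def)

lemma interlacing_partition:
  assumes "\<nu> \<in> interlacing \<mu>"
  shows "sorted_wrt (\<ge>) \<nu>"
proof -
  have "\<nu> ! Suc i \<le> \<nu> ! i" if "Suc i < length \<nu>" for i
  proof -
    have "\<nu> ! Suc i \<le> \<mu> ! Suc i" "row_floor \<mu> i \<le> \<nu> ! i" "length \<nu> = length \<mu>"
      using assms that Suc_lessD[OF that] by (auto simp: interlacing_def)
    with that show ?thesis by (simp add: row_floor_def)
  qed
  then show ?thesis
    by (subst sorted_wrt_iff_nth_Suc_transp) (auto simp: transp_def)
qed

lemma sorted_split_top:
  assumes "sorted r" "set r \<subseteq> {..<Suc N}"
  shows "r = filter (\<lambda>e. e < N) r @ replicate (length r - length (filter (\<lambda>e. e < N) r)) (N::nat)"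
  using assms
proof (induction r)
  case (Cons e r)
  show ?case
  proof (cases "e < N")
    case False
    with Cons.prems have "set (e # r) \<subseteq> {N}" by force
    then have "e # r = replicate (length (e # r)) N"
      by (metis replicate_length_same singletonD subsetD)
    moreover have "filter (\<lambda>e. e < N) (e # r) = []"
      using \<open>set (e # r) \<subseteq> {N}\<close> by (auto simp: filter_empty_conv)
    ultimately show ?thesis by (metis append_Nil diff_zero list.size(3))
  qed (use Cons in simp)
qed simp

lemma tableauxD:
  assumes "T \<in> tableaux N \<mu>"
  shows "length T = length \<mu>"
    and "i < length \<mu> \<Longrightarrow> length (T ! i) = \<mu> ! i"
    and "i < length \<mu> \<Longrightarrow> sorted (T ! i)"
    and "i < length \<mu> \<Longrightarrow> set (T ! i) \<subseteq> {..<N}"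
    and "Suc i < length \<mu> \<Longrightarrow> j < \<mu> ! Suc i \<Longrightarrow> T ! i ! j < T ! Suc i ! j"
proof -
  have *: "map length T = \<mu>" and T: "semistandard T \<mu>" "set (concat T) \<subseteq> {..<N}"
    using assms by (auto simp: tableaux_def semistandard_def)
  show len: "length T = length \<mu>" using * by (metis length_map)
  show lenr: "length (T ! i) = \<mu> ! i" if "i < length \<mu>" for i
    using * len that by (metis nth_map)
  have row: "T ! i \<in> set T" if "i < length \<mu>" using that len by simp
  show "i < length \<mu> \<Longrightarrow> sorted (T ! i)"
    using T(1) row by (simp add: semistandard_def)
  show "i < length \<mu> \<Longrightarrow> set (T ! i) \<subseteq> {..<N}"
    using T(2) row by auto
  show "Suc i < length \<mu> \<Longrightarrow> j < \<mu> ! Suc i \<Longrightarrow> T ! i ! j < T ! Suc i ! j"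
    using T len lenr by (simp add: semistandard_def)
qed

lemma tableauxI:
  assumes len: "length T = length \<mu>"
    and rows: "\<And>i. i < length \<mu> \<Longrightarrow>
      length (T ! i) = \<mu> ! i \<and> sorted (T ! i) \<and> set (T ! i) \<subseteq> {..<N}"
    and columns: "\<And>i j. Suc i < length \<mu> \<Longrightarrow> j < \<mu> ! Suc i \<Longrightarrow> T ! i ! j < T ! Suc i ! j"
  shows "T \<in> tableaux N \<mu>"
proof -
  have "map length T = \<mu>"
    using len rows by (intro nth_equalityI) auto
  moreover have "sorted row \<and> set row \<subseteq> {..<N}" if "row \<in> set T" for row
    using that len rows by (metis in_set_conv_nth)
  ultimately show ?thesis
    using len rows columns by (auto simp: tableaux_def semistandard_def)
qed

lemma prod_list_concat_eq_prod:
  "prod_list (map x (concat T)) = (\<Prod>i<length T. prod_list (map x (T ! i)) :: 'a::comm_monoid_mult)"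
  by (induction T) (simp_all add: prod.lessThan_Suc_shift del: prod.lessThan_Suc)

text \<open>
  Removing the entries \<open>N\<close>, and putting them back at the ends of the rows, are the two directions of
  the bijection behind the branching rule.
\<close>

definition strip_top :: "nat \<Rightarrow> nat list list \<Rightarrow> nat list list" where
  "strip_top N T = map (filter (\<lambda>e. e < N)) T"

definition fill_top :: "nat \<Rightarrow> nat list \<Rightarrow> nat list list \<Rightarrow> nat list list" where
  "fill_top N \<mu> T = map (\<lambda>i. T ! i @ replicate (\<mu> ! i - length (T ! i)) N) [0..<length \<mu>]"

lemma strip_top:
  assumes \<mu>: "sorted_wrt (\<ge>) \<mu>" and T: "T \<in> tableaux (Suc N) \<mu>"
  defines "T' \<equiv> strip_top N T"
  shows "map length T' \<in> interlacing \<mu>" "T' \<in> tableaux N (map length T')" "fill_top N \<mu> T' = T"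
proof -
  note TD = tableauxD[OF T]
  have len: "length T' = length \<mu>" by (simp add: T'_def strip_top_def TD)
  have row: "T' ! i = filter (\<lambda>e. e < N) (T ! i)" if "i < length \<mu>" for i
    using that TD(1) by (simp add: T'_def strip_top_def)
  have split: "T ! i = T' ! i @ replicate (\<mu> ! i - length (T' ! i)) N" if "i < length \<mu>" for i
    using sorted_split_top[OF TD(3,4)[OF that]] TD(2)[OF that] row[OF that] by simp
  have short: "length (T' ! i) \<le> \<mu> ! i" if "i < length \<mu>" for i
    using row[OF that] TD(2)[OF that] by (metis length_filter_le)
  \<comment> \<open>An \<open>N\<close> in row \<open>i\<close> cannot have an entry below it, because that entry would exceed \<open>N\<close>.\<close>
  have below: "\<mu> ! Suc i \<le> length (T' ! i)" if i: "Suc i < length \<mu>" for i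
  proof (rule ccontr)
    let ?j = "length (T' ! i)"
    assume "\<not> \<mu> ! Suc i \<le> ?j"
    then have j: "?j < \<mu> ! Suc i" "?j < \<mu> ! i"
      using partition_nth_Suc[OF \<mu> i] by auto
    then have "T ! i ! ?j = N"
      using split[of i] i by (metis Suc_lessD cancel_comm_monoid_add_class.diff_cancel
          nth_append_length_plus add_0_right nth_replicate zero_less_diff)
    then have "N < T ! Suc i ! ?j" using TD(5)[OF i j(1)] by simp
    moreover have "T ! Suc i ! ?j \<in> set (T ! Suc i)" using TD(2)[OF i] j by simp
    ultimately show False using TD(4)[OF i] by auto
  qed
  show "map length T' \<in> interlacing \<mu>"
    using len short below by (auto simp: interlacing_def row_floor_def)
  show "fill_top N \<mu> T' = T"
    using split TD(1) by (intro nth_equalityI) (auto simp: fill_top_def)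
  show "T' \<in> tableaux N (map length T')"
  proof (rule tableauxI)
    fix i assume "i < length (map length T')"
    then show "length (T' ! i) = map length T' ! i \<and> sorted (T' ! i) \<and> set (T' ! i) \<subseteq> {..<N}"
      using row TD(3) len by (auto intro: sorted_wrt_filter)
  next
    fix i j assume "Suc i < length (map length T')" "j < map length T' ! Suc i"
    then have ij: "Suc i < length \<mu>" "j < length (T' ! Suc i)" using len by auto
    then have "j < \<mu> ! Suc i" using short[of "Suc i"] by simp
    moreover have "j < length (T' ! i)" using below[OF ij(1)] calculation by simp
    ultimately show "T' ! i ! j < T' ! Suc i ! j"
      using TD(5)[OF ij(1), of j] split[of i] split[of "Suc i"] ij
      by (metis Suc_lessD nth_append)
  qed simp
qed

lemma fill_top:
  assumes \<mu>: "sorted_wrt (\<ge>) \<mu>" and \<nu>: "\<nu> \<in> interlacing \<mu>" and T: "T \<in> tableaux N \<nu>"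
  shows "fill_top N \<mu> T \<in> tableaux (Suc N) \<mu>" "strip_top N (fill_top N \<mu> T) = T" "map length T = \<nu>"
proof -
  note TD = tableauxD[OF T]
  have len: "length \<nu> = length \<mu>" using \<nu> by (simp add: interlacing_def)
  have row: "fill_top N \<mu> T ! i = T ! i @ replicate (\<mu> ! i - \<nu> ! i) N" if "i < length \<mu>" for i
    using that TD(2)[of i] len by (simp add: fill_top_def)
  have le: "\<nu> ! i \<le> \<mu> ! i" if "i < length \<mu>" for i
    using \<nu> that by (simp add: interlacing_def)
  show "map length T = \<nu>"
    using TD(1,2) by (intro nth_equalityI) auto
  show "strip_top N (fill_top N \<mu> T) = T"
  proof (rule nth_equalityI)
    show "length (strip_top N (fill_top N \<mu> T)) = length T"
      using TD(1) len by (simp add: strip_top_def fill_top_def)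
  next
    fix i assume "i < length (strip_top N (fill_top N \<mu> T))"
    then have i: "i < length \<mu>" by (simp add: strip_top_def fill_top_def)
    have "filter (\<lambda>e. e < N) (T ! i) = T ! i"
      using TD(4)[of i] i len by (auto simp: filter_id_conv)
    then show "strip_top N (fill_top N \<mu> T) ! i = T ! i"
      using i row[OF i] by (simp add: strip_top_def fill_top_def)
  qed
  show "fill_top N \<mu> T \<in> tableaux (Suc N) \<mu>"
  proof (rule tableauxI)
    show "length (fill_top N \<mu> T) = length \<mu>" by (simp add: fill_top_def)
  next
    fix i assume i: "i < length \<mu>"
    have "set (T ! i) \<subseteq> {..<N}" using TD(4) i len by simp
    then show "length (fill_top N \<mu> T ! i) = \<mu> ! i \<and> sorted (fill_top N \<mu> T ! i) \<and>
        set (fill_top N \<mu> T ! i) \<subseteq> {..<Suc N}"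
      using i len TD(2,3)[of i] le[OF i] row[OF i]
      by (auto simp: sorted_append intro: less_imp_le)
  next
    fix i j assume i: "Suc i < length \<mu>" and j: "j < \<mu> ! Suc i"
    have "row_floor \<mu> i \<le> \<nu> ! i"
      using \<nu> Suc_lessD[OF i] by (simp add: interlacing_def)
    then have "\<mu> ! Suc i \<le> \<nu> ! i" using i by (simp add: row_floor_def)
    with j have ji: "j < length (T ! i)" using TD(2)[of i] i len by simp
    then have left: "fill_top N \<mu> T ! i ! j = T ! i ! j" "T ! i ! j \<in> set (T ! i)"
      using row[of i] i by (auto simp: nth_append)
    then have "T ! i ! j < N" using TD(4)[of i] i len by auto
    then show "fill_top N \<mu> T ! i ! j < fill_top N \<mu> T ! Suc i ! j"
      using left row[OF i] j TD(2)[of "Suc i"] TD(5)[of i j] i len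
      by (simp add: nth_append)
  qed
qed

text \<open>
  A tableau with entries at most \<open>N\<close> is the same as a tableau with entries below \<open>N\<close> on a smaller shape
  together with the horizontal strip filled with \<open>N\<close>; the strip alone determines the exponent of \<open>x N\<close>.
  That exponent is kept as a product over the rows, which is the form that expanding a determinant
  row by row produces.
\<close>

lemma schur_poly_branching:
  assumes \<mu>: "sorted_wrt (\<ge>) \<mu>"
  shows "schur_poly x (Suc N) \<mu> =
    (\<Sum>\<nu>\<in>interlacing \<mu>. (\<Prod>i<length \<mu>. x N ^ (\<mu> ! i - \<nu> ! i)) * schur_poly x N \<nu>)"
proof -
  have weight: "prod_list (map x (concat (fill_top N \<mu> T))) =
      (\<Prod>i<length \<mu>. x N ^ (\<mu> ! i - \<nu> ! i)) * prod_list (map x (concat T))"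
    if "\<nu> \<in> interlacing \<mu>" "T \<in> tableaux N \<nu>" for \<nu> T
  proof -
    have len: "length \<nu> = length \<mu>" using that by (simp add: interlacing_def)
    note TD = tableauxD[OF that(2), unfolded len]
    have "prod_list (map x (concat (fill_top N \<mu> T))) =
        (\<Prod>i<length \<mu>. x N ^ (\<mu> ! i - \<nu> ! i) * prod_list (map x (T ! i)))"
      unfolding prod_list_concat_eq_prod
      by (intro prod.cong) (auto simp: fill_top_def TD(2) prod_list_replicate mult.commute)
    then show ?thesis by (simp add: prod_list_concat_eq_prod TD(1) prod.distrib)
  qed
  have "schur_poly x (Suc N) \<mu> = (\<Sum>(\<nu>, T)\<in>Sigma (interlacing \<mu>) (tableaux N).
      (\<Prod>i<length \<mu>. x N ^ (\<mu> ! i - \<nu> ! i)) * prod_list (map x (concat T)))"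
    unfolding schur_poly_def
  proof (rule sum.reindex_bij_witness[where i = "\<lambda>(\<nu>, T). fill_top N \<mu> T"
        and j = "\<lambda>T. (map length (strip_top N T), strip_top N T)"])
    fix T assume T: "T \<in> tableaux (Suc N) \<mu>"
    note strip = strip_top[OF \<mu> T]
    show "(case (map length (strip_top N T), strip_top N T) of (\<nu>, T) \<Rightarrow> fill_top N \<mu> T) = T"
      using strip by simp
    show "(map length (strip_top N T), strip_top N T) \<in> Sigma (interlacing \<mu>) (tableaux N)"
      using strip by simp
    show "(case (map length (strip_top N T), strip_top N T) of (\<nu>, T) \<Rightarrow>
        (\<Prod>i<length \<mu>. x N ^ (\<mu> ! i - \<nu> ! i)) * prod_list (map x (concat T))) =
        prod_list (map x (concat T))"
      using weight[OF strip(1,2)] strip(3) by simp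
  next
    fix p assume "p \<in> Sigma (interlacing \<mu>) (tableaux N)"
    then obtain \<nu> T where p: "p = (\<nu>, T)" "\<nu> \<in> interlacing \<mu>" "T \<in> tableaux N \<nu>" by auto
    show "(case p of (\<nu>, T) \<Rightarrow> fill_top N \<mu> T) \<in> tableaux (Suc N) \<mu>"
      "(map length (strip_top N (case p of (\<nu>, T) \<Rightarrow> fill_top N \<mu> T)),
        strip_top N (case p of (\<nu>, T) \<Rightarrow> fill_top N \<mu> T)) = p"
      using fill_top[OF \<mu> p(2,3)] p(1) by simp_all
  qed
  also have "\<dots> = (\<Sum>\<nu>\<in>interlacing \<mu>. \<Sum>T\<in>tableaux N \<nu>.
      (\<Prod>i<length \<mu>. x N ^ (\<mu> ! i - \<nu> ! i)) * prod_list (map x (concat T)))"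
    by (rule sum.Sigma[symmetric]) (auto simp: finite_interlacing finite_tableaux)
  finally show ?thesis by (simp add: schur_poly_def sum_distrib_left)
qed

lemma schur_poly_0: "schur_poly x 0 \<mu> = (if set \<mu> \<subseteq> {0} then 1 else 0)"
proof -
  have "T = replicate (length \<mu>) [] \<and> set \<mu> \<subseteq> {0}" if T: "T \<in> tableaux 0 \<mu>" for T
  proof
    have empty: "T ! i = []" if "i < length \<mu>" for i
      using tableauxD(4)[OF T that] by simp
    show "T = replicate (length \<mu>) []"
      using tableauxD(1)[OF T] empty by (intro nth_equalityI) simp_all
    have "\<mu> ! i = 0" if "i < length \<mu>" for i
      using tableauxD(2)[OF T that] empty[OF that] by simp
    then show "set \<mu> \<subseteq> {0}" by (metis in_set_conv_nth singletonI subsetI)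
  qed
  moreover have "replicate (length \<mu>) [] \<in> tableaux 0 \<mu>" if "set \<mu> \<subseteq> {0}"
  proof -
    have "\<mu> ! i = 0" if "i < length \<mu>" for i
      using nth_mem[OF that] \<open>set \<mu> \<subseteq> {0}\<close> by blast
    then show ?thesis by (intro tableauxI) simp_all
  qed
  ultimately have "tableaux 0 \<mu> = (if set \<mu> \<subseteq> {0} then {replicate (length \<mu>) []} else {})"
    by auto
  then show ?thesis by (simp add: schur_poly_def)
qed


section \<open>The Jacobi--Trudi determinant\<close>

text \<open>
  The complete homogeneous symmetric polynomials. The degree is an integer because the entries of the
  Jacobi--Trudi matrix to the left of the diagonal may have negative degree; in that case the sum below
  reduces to its term \<open>i = 0\<close> and the value is 0.
\<close>

fun complete_poly :: "(nat \<Rightarrow> 'a::comm_ring_1) \<Rightarrow> nat \<Rightarrow> int \<Rightarrow> 'a" where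
  "complete_poly x 0 k = (if k = 0 then 1 else 0)"
| "complete_poly x (Suc N) k = (\<Sum>i\<le>nat k. x N ^ i * complete_poly x N (k - int i))"

lemma complete_poly_neg: "k < 0 \<Longrightarrow> complete_poly x N k = 0"
  by (induction N arbitrary: k) auto

lemma complete_poly_rec:
  "complete_poly x (Suc N) k = complete_poly x N k + x N * complete_poly x (Suc N) (k - 1)"
proof (cases "k \<le> 0")
  case True
  then show ?thesis by (simp add: complete_poly_neg)
next
  case False
  then have "nat k = Suc (nat (k - 1))" by simp
  then have "complete_poly x (Suc N) k = (\<Sum>i\<le>Suc (nat (k - 1)). x N ^ i * complete_poly x N (k - int i))"
    by simp
  then show ?thesis
    by (simp add: sum.atMost_Suc_shift sum_distrib_left mult.assoc algebra_simps
        del: sum.atMost_Suc)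
qed

text \<open>
  Over the variables below \<open>Suc N\<close> the polynomial of degree \<open>k\<close> is a sum over all exponents of
  \<open>x N\<close>; the difference keeps the exponents up to \<open>d\<close>. This is the effect of the row operation on one
  entry of the Jacobi--Trudi matrix.
\<close>

lemma complete_poly_difference:
  "complete_poly x (Suc N) k - x N ^ Suc d * complete_poly x (Suc N) (k - int (Suc d)) =
     (\<Sum>i\<le>d. x N ^ i * complete_poly x N (k - int i))"
proof (induction d)
  case 0
  show ?case using complete_poly_rec[of x N k] by simp
next
  case (Suc d)
  have "x N ^ Suc d * complete_poly x (Suc N) (k - int (Suc d)) =
      x N ^ Suc d * complete_poly x N (k - int (Suc d)) +
      x N ^ Suc (Suc d) * complete_poly x (Suc N) (k - int (Suc (Suc d)))"
    by (subst complete_poly_rec) (simp add: algebra_simps del: complete_poly.simps)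
  then show ?case using Suc.IH
    by (simp add: algebra_simps del: complete_poly.simps)
qed

definition jacobi_trudi_mat :: "(int \<Rightarrow> 'a::comm_ring_1) \<Rightarrow> nat list \<Rightarrow> 'a mat" where
  "jacobi_trudi_mat h \<mu> =
     mat (length \<mu>) (length \<mu>) (\<lambda>(i, j). h (int (\<mu> ! i) + int j - int i))"

text \<open>
  Multilinearity of the determinant in all rows at once, with a separate index set for each row; it
  comes from distributing the products in the Leibniz formula over the inner sums.
\<close>

lemma det_mat_sum_rows:
  fixes w :: "nat \<Rightarrow> 'c \<Rightarrow> 'a::comm_ring_1"
  assumes "\<And>i. i < n \<Longrightarrow> finite (S i)"
  shows "det (mat n n (\<lambda>(i, j). \<Sum>c\<in>S i. w i c * g i c j)) =
    (\<Sum>f\<in>Pi\<^sub>E {0..<n} S. (\<Prod>i\<in>{0..<n}. w i (f i)) * det (mat n n (\<lambda>(i, j). g i (f i) j)))"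
proof -
  let ?P = "{p. p permutes {0..<n}}"
  have entries: "(\<Prod>i = 0..<n. mat n n (\<lambda>(i, j). G i j) $$ (i, p i)) = (\<Prod>i = 0..<n. G i (p i))"
    if "p \<in> ?P" for p and G :: "nat \<Rightarrow> nat \<Rightarrow> 'a"
    using that by (intro prod.cong) (auto dest: permutes_in_image[where x = i for i])
  have dm: "det (mat n n (\<lambda>(i, j). G i j)) = (\<Sum>p\<in>?P. signof p * (\<Prod>i = 0..<n. G i (p i)))"
    for G :: "nat \<Rightarrow> nat \<Rightarrow> 'a"
    using entries by (simp add: det_def)
  have "det (mat n n (\<lambda>(i, j). \<Sum>c\<in>S i. w i c * g i c j)) =
      (\<Sum>p\<in>?P. \<Sum>f\<in>Pi\<^sub>E {0..<n} S. signof p * (\<Prod>i = 0..<n. w i (f i) * g i (f i) (p i)))"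
    unfolding dm using assms
    by (intro sum.cong refl, subst prod_sum_PiE) (auto simp: sum_distrib_left)
  also have "\<dots> = (\<Sum>f\<in>Pi\<^sub>E {0..<n} S. \<Sum>p\<in>?P. signof p * (\<Prod>i = 0..<n. w i (f i) * g i (f i) (p i)))"
    by (rule sum.swap)
  also have "\<dots> = (\<Sum>f\<in>Pi\<^sub>E {0..<n} S. (\<Prod>i\<in>{0..<n}. w i (f i)) * det (mat n n (\<lambda>(i, j). g i (f i) j)))"
    unfolding dm by (simp add: prod.distrib sum_distrib_left ac_simps)
  finally show ?thesis .
qed

text \<open>
  The counterpart of \<open>schur_poly_branching\<close>. Subtracting \<open>x N ^ (\<mu> ! i - \<mu> ! Suc i + 1)\<close> times row
  \<open>Suc i\<close> from row \<open>i\<close> does not change the determinant. It cuts the expansion of row \<open>i\<close> in powers of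
  \<open>x N\<close> off exactly where the row lengths would drop below \<open>\<mu> ! Suc i\<close>. So the choices of one
  summand in each row correspond to the shapes that interlace with \<open>\<mu>\<close>.
\<close>

lemma det_jacobi_trudi_mat_branching:
  fixes x :: "nat \<Rightarrow> 'a::comm_ring_1"
  assumes \<mu>: "sorted_wrt (\<ge>) \<mu>"
  shows "det (jacobi_trudi_mat (complete_poly x (Suc N)) \<mu>) =
    (\<Sum>\<nu>\<in>interlacing \<mu>. (\<Prod>i<length \<mu>. x N ^ (\<mu> ! i - \<nu> ! i)) *
       det (jacobi_trudi_mat (complete_poly x N) \<nu>))"
proof -
  define n where "n = length \<mu>"
  define h where "h = complete_poly x (Suc N)"
  define H where "H = jacobi_trudi_mat h \<mu>"
  \<comment> \<open>Multiplication by the unitriangular matrix \<open>U\<close> performs all row operations at once.\<close>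
  define U where "U = mat n n (\<lambda>(i, k). if k = i then 1 else
      if k = Suc i then - (x N ^ Suc (\<mu> ! i - \<mu> ! Suc i)) else 0)"
  define S where "S = (\<lambda>i. {row_floor \<mu> i..\<mu> ! i})"
  have carrier: "U \<in> carrier_mat n n" "H \<in> carrier_mat n n"
    by (simp_all add: U_def H_def jacobi_trudi_mat_def n_def)
  have "det U = prod_list (diag_mat U)"
    by (rule det_upper_triangular[OF _ carrier(1)]) (auto simp: U_def)
  also have "\<dots> = 1"
    unfolding prod_list_diag_prod by (rule prod.neutral) (simp add: U_def)
  finally have "det (U * H) = det H"
    by (simp add: det_mult[OF carrier])
  moreover have "U * H = mat n n (\<lambda>(i, j). \<Sum>c\<in>S i.
      x N ^ (\<mu> ! i - c) * complete_poly x N (int c + int j - int i))"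
  proof (rule eq_matI)
    fix i j assume "i < dim_row (mat n n (\<lambda>(i, j). \<Sum>c\<in>S i.
        x N ^ (\<mu> ! i - c) * complete_poly x N (int c + int j - int i)))"
      and "j < dim_col (mat n n (\<lambda>(i, j). \<Sum>c\<in>S i.
        x N ^ (\<mu> ! i - c) * complete_poly x N (int c + int j - int i)))"
    then have ij: "i < n" "j < n" by auto
    define d where "d = \<mu> ! i - row_floor \<mu> i"
    define k where "k = int (\<mu> ! i) + int j - int i"
    have d: "int d = int (\<mu> ! i) - int (row_floor \<mu> i)" "d \<le> \<mu> ! i"
      using row_floor_le[OF \<mu>] ij by (auto simp: d_def n_def)
    have "(U * H) $$ (i, j) = (\<Sum>l<n. U $$ (i, l) * H $$ (l, j))"
      using ij carrier by (simp add: scalar_prod_def atLeast0LessThan)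
    also have "\<dots> = (\<Sum>l<n. (if l = i then H $$ (i, j) else 0) +
        (if l = Suc i then - (x N ^ Suc d * H $$ (Suc i, j)) else 0))"
      using ij by (intro sum.cong) (auto simp: U_def d_def row_floor_def n_def)
    also have "\<dots> = h k - x N ^ Suc d * h (k - int (Suc d))"
    proof (cases "Suc i < n")
      case True
      then have "int (\<mu> ! Suc i) + int j - int (Suc i) = k - int (Suc d)"
        using d by (simp add: k_def row_floor_def n_def)
      then have "H $$ (Suc i, j) = h (k - int (Suc d))"
        using True ij by (simp only: H_def jacobi_trudi_mat_def n_def index_mat prod.case)
      with True ij show ?thesis
        by (simp add: sum.distrib H_def jacobi_trudi_mat_def n_def k_def)
    next
      case False
      \<comment> \<open>There is no next row to subtract, but the term it would contribute has negative degree.\<close>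
      then have "k - int (Suc d) < 0"
        using ij d by (simp add: k_def row_floor_def n_def)
      then have "h (k - int (Suc d)) = 0" unfolding h_def by (rule complete_poly_neg)
      with False ij show ?thesis
        by (simp add: sum.distrib H_def jacobi_trudi_mat_def n_def k_def)
    qed
    also have "\<dots> = (\<Sum>e\<le>d. x N ^ e * complete_poly x N (k - int e))"
      unfolding h_def by (rule complete_poly_difference)
    also have "\<dots> = (\<Sum>c\<in>S i. x N ^ (\<mu> ! i - c) * complete_poly x N (int c + int j - int i))"
      using d
      by (intro sum.reindex_bij_witness[where i = "\<lambda>c. \<mu> ! i - c" and j = "\<lambda>e. \<mu> ! i - e"])
        (auto simp: S_def k_def d_def algebra_simps)
    finally show "(U * H) $$ (i, j) = mat n n (\<lambda>(i, j). \<Sum>c\<in>S i.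
        x N ^ (\<mu> ! i - c) * complete_poly x N (int c + int j - int i)) $$ (i, j)"
      using ij by simp
  qed (use carrier in auto)
  ultimately have "det H = (\<Sum>f\<in>Pi\<^sub>E {0..<n} S. (\<Prod>i\<in>{0..<n}. x N ^ (\<mu> ! i - f i)) *
      det (mat n n (\<lambda>(i, j). complete_poly x N (int (f i) + int j - int i))))"
    using det_mat_sum_rows[of n S "\<lambda>i c. x N ^ (\<mu> ! i - c)"
        "\<lambda>i c j. complete_poly x N (int c + int j - int i)"]
    by (simp add: S_def)
  also have "\<dots> = (\<Sum>\<nu>\<in>interlacing \<mu>. (\<Prod>i<length \<mu>. x N ^ (\<mu> ! i - \<nu> ! i)) *
       det (jacobi_trudi_mat (complete_poly x N) \<nu>))"
  proof (rule sum.reindex_bij_witness[where i = "\<lambda>\<nu>. restrict ((!) \<nu>) {0..<n}"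
        and j = "\<lambda>f. map f [0..<n]"])
    fix f assume f: "f \<in> Pi\<^sub>E {0..<n} S"
    show "restrict ((!) (map f [0..<n])) {0..<n} = f"
      using f by (auto simp: fun_eq_iff restrict_def PiE_def extensional_def)
    show "map f [0..<n] \<in> interlacing \<mu>"
      using f by (auto simp: interlacing_def S_def n_def PiE_def Pi_def)
    have "mat n n (\<lambda>(i, j). complete_poly x N (int (f i) + int j - int i)) =
        jacobi_trudi_mat (complete_poly x N) (map f [0..<n])"
      by (rule eq_matI) (auto simp: jacobi_trudi_mat_def)
    then show "(\<Prod>i<length \<mu>. x N ^ (\<mu> ! i - map f [0..<n] ! i)) *
        det (jacobi_trudi_mat (complete_poly x N) (map f [0..<n])) =
        (\<Prod>i\<in>{0..<n}. x N ^ (\<mu> ! i - f i)) *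
        det (mat n n (\<lambda>(i, j). complete_poly x N (int (f i) + int j - int i)))"
      by (simp add: n_def atLeast0LessThan)
  next
    fix \<nu> assume \<nu>: "\<nu> \<in> interlacing \<mu>"
    show "map (restrict ((!) \<nu>) {0..<n}) [0..<n] = \<nu>"
      using \<nu> by (intro nth_equalityI) (auto simp: interlacing_def n_def)
    show "restrict ((!) \<nu>) {0..<n} \<in> Pi\<^sub>E {0..<n} S"
      using \<nu> by (auto simp: interlacing_def n_def S_def)
  qed
  finally show ?thesis by (simp add: H_def h_def)
qed

theorem schur_poly_eq_det_jacobi_trudi_mat:
  assumes "sorted_wrt (\<ge>) \<mu>"
  shows "schur_poly x N \<mu> = det (jacobi_trudi_mat (complete_poly x N) \<mu>)"
  using assms
proof (induction N arbitrary: \<mu>)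
  case 0
  show ?case
  proof (cases "set \<mu> \<subseteq> {0}")
    case True
    then have "\<mu> ! i = 0" if "i < length \<mu>" for i using that by (auto simp: subset_iff)
    then have "jacobi_trudi_mat (complete_poly x 0) \<mu> = 1\<^sub>m (length \<mu>)"
      by (intro eq_matI) (auto simp: jacobi_trudi_mat_def)
    with True show ?thesis by (simp add: schur_poly_0 del: complete_poly.simps)
  next
    case False
    then obtain y where "y \<in> set \<mu>" "0 < y" by auto
    then obtain i where i: "i < length \<mu>" "0 < \<mu> ! i"
      by (metis in_set_conv_nth)
    have "0 < \<mu> ! 0"
      using sorted_wrt_nth_less[OF 0, of 0 i] i by (cases i) auto
    \<comment> \<open>The first row of the matrix vanishes, since all its indices are positive.\<close>
    then have "jacobi_trudi_mat (complete_poly x 0) \<mu> $$ (0, p 0) = 0"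
      if "p permutes {0..<length \<mu>}" for p
      using i(1) permutes_in_image[OF that, of 0] by (auto simp: jacobi_trudi_mat_def)
    then have "(\<Prod>i = 0..<length \<mu>. jacobi_trudi_mat (complete_poly x 0) \<mu> $$ (i, p i)) = 0"
      if "p permutes {0..<length \<mu>}" for p
      using that i(1) by (intro prod_zero bexI[of _ 0]) auto
    then have "det (jacobi_trudi_mat (complete_poly x 0) \<mu>) = 0"
      by (subst det_def'[of _ "length \<mu>"]) (auto simp: jacobi_trudi_mat_def)
    with False show ?thesis by (simp add: schur_poly_0 del: complete_poly.simps)
  qed
next
  case (Suc N)
  then show ?case
    by (simp add: schur_poly_branching det_jacobi_trudi_mat_branching interlacing_partition
        del: complete_poly.simps cong: sum.cong)
qed


section \<open>The four-row determinant\<close>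

text \<open>Expansion along the first row, in a form that the simplifier can iterate on concrete sizes.\<close>

lemma det_mat_Suc:
  fixes f :: "nat \<times> nat \<Rightarrow> 'a::comm_ring_1"
  shows "det (mat (Suc n) (Suc n) f) =
    (\<Sum>j<Suc n. f (0, j) * ((-1) ^ j * det (mat n n (\<lambda>(i, k). f (Suc i, if k < j then k else Suc k)))))"
proof -
  have "mat_delete (mat (Suc n) (Suc n) f) 0 j =
      mat n n (\<lambda>(i, k). f (Suc i, if k < j then k else Suc k))" if "j < Suc n" for j
    using that by (intro eq_matI) (auto simp: mat_delete_def)
  then show ?thesis
    by (subst laplace_expansion_row[of _ "Suc n" 0]) (auto simp: cofactor_def intro!: sum.cong)
qed

text \<open>
  The two-row Jacobi--Trudi determinant for the shape \<open>(p, q)\<close>, extended to all integers. For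
  the shape \<open>(a, a, b, b)\<close>, the minors of size 2 in the first two or the last two rows of the
  Jacobi--Trudi matrix are all of this form.
\<close>

definition two_row_minor :: "(int \<Rightarrow> 'a::comm_ring_1) \<Rightarrow> int \<Rightarrow> int \<Rightarrow> 'a" where
  "two_row_minor h p q = h p * h q - h (p + 1) * h (q - 1)"

text \<open>
  Expanding the determinant for \<open>(a, a, b, b)\<close> along its first two rows gives six products of
  complementary minors. These are the three whose first factor uses column 1, together with one of
  the columns 2, 3, 4.
\<close>

definition half_laplace :: "(int \<Rightarrow> 'a::comm_ring_1) \<Rightarrow> int \<Rightarrow> int \<Rightarrow> 'a" where
  "half_laplace h a b =
     two_row_minor h a a * two_row_minor h b b
     - two_row_minor h (a + 1) a * two_row_minor h b (b - 1)
     + two_row_minor h (a + 2) a * two_row_minor h (b - 1) (b - 1)"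

lemma det_jacobi_trudi_mat_two_rows:
  "det (jacobi_trudi_mat h [p, q]) = two_row_minor h (int p) (int q)"
  by (simp add: jacobi_trudi_mat_def two_row_minor_def numeral_2_eq_2 det_mat_Suc algebra_simps)

text \<open>
  The rows of this matrix start with \<open>h\<close> at \<open>a\<close>, \<open>a - 1\<close>, \<open>b - 2\<close>, \<open>b - 3\<close>. Exchanging \<open>a\<close> with \<open>b - 2\<close>
  therefore exchanges the upper pair of rows with the lower pair, an even permutation that maps the
  three products of \<open>half_laplace\<close> to the other three.
\<close>

lemma det_jacobi_trudi_mat_four_rows:
  "det (jacobi_trudi_mat h [a, a, b, b]) =
     half_laplace h (int a) (int b) + half_laplace h (int b - 2) (int a + 2)"
proof -
  define A B where "A = int a" and "B = int b"
  have "det (jacobi_trudi_mat h [a, a, b, b]) = half_laplace h A B + half_laplace h (B - 2) (A + 2)"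
    by (simp add: jacobi_trudi_mat_def det_mat_Suc half_laplace_def two_row_minor_def algebra_simps
        flip: A_def B_def)
  then show ?thesis by (simp add: A_def B_def)
qed

lemma half_laplace_neg:
  assumes "\<And>k. k < 0 \<Longrightarrow> h k = 0"
  shows "a < 0 \<Longrightarrow> half_laplace h a b = 0" "b < 0 \<Longrightarrow> half_laplace h a b = 0"
  by (simp_all add: half_laplace_def two_row_minor_def assms)

text \<open>
  For \<open>a - b \<in> {-1, -2, -3}\<close> the numbers \<open>a\<close>, \<open>a - 1\<close>, \<open>b - 2\<close>, \<open>b - 3\<close> are not distinct, so the four-row
  determinant has two equal rows. For the difference \<open>-2\<close> the two halves of the determinant coincide;
  the relation below is the vanishing of one of them, the Pluecker relation for two rows and four
  columns.
\<close>

lemma half_laplace_gap_two: "half_laplace h (b - 2) b = 0"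
  by (simp add: half_laplace_def two_row_minor_def algebra_simps)

text \<open>Here the exchange of \<open>a\<close> with \<open>b - 2\<close> pairs the differences \<open>-1\<close> and \<open>-3\<close>.\<close>

lemma half_laplace_gap_one_three:
  "half_laplace h (b - 1) b + half_laplace h (b - 2) (b + 1) = 0"
  by (simp add: half_laplace_def two_row_minor_def algebra_simps)

text \<open>
  Folding the sum: the reflection of \<open>a\<close> to \<open>n - a - 2\<close> carries the pairs with \<open>a - b \<ge> 0\<close>, where
  \<open>b = n - a\<close>, to those with \<open>a - b \<le> -4\<close>, and what lies between adds up to zero.
\<close>

lemma sum_half_laplace:
  assumes "\<And>k. k < 0 \<Longrightarrow> h k = 0"
  shows "(\<Sum>a\<in>{0..int n}. half_laplace h a (int n - a)) =
    (\<Sum>a\<in>{a. int n \<le> 2 * a \<and> a \<le> int n}.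
       half_laplace h a (int n - a) + half_laplace h (int n - a - 2) (a + 2))"
proof -
  define g where "g = (\<lambda>a. half_laplace h a (int n - a))"
  define upper where "upper = {a. int n \<le> 2 * a \<and> a \<le> int n}"
  define lower where "lower = {a. - 2 \<le> a \<and> 2 * a \<le> int n - 4}"
  define gap where "gap = {a. int n - 4 < 2 * a \<and> 2 * a < int n}"
  have fin: "finite upper" "finite lower" "finite gap"
    by (rule finite_subset[of _ "{-4..int n}"]; force simp: upper_def lower_def gap_def)+
  \<comment> \<open>The reflection of \<open>a = n\<close> is \<open>-2\<close>, so the range is extended to \<open>-2\<close> by zero terms.\<close>
  have "(\<Sum>a\<in>{0..int n}. g a) = (\<Sum>a\<in>{-2..int n}. g a)"
    by (rule sum.mono_neutral_left) (auto simp: g_def half_laplace_neg assms)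
  also have "{-2..int n} = upper \<union> (lower \<union> gap)"
    by (auto simp: upper_def lower_def gap_def)
  also have "sum g \<dots> = sum g upper + (sum g lower + sum g gap)"
    using fin by (subst sum.union_disjoint; auto simp: upper_def lower_def gap_def)+
  also have "sum g lower = (\<Sum>a\<in>upper. g (int n - a - 2))"
    by (rule sum.reindex_bij_witness[where i = "\<lambda>a. int n - a - 2" and j = "\<lambda>a. int n - a - 2"])
      (auto simp: upper_def lower_def)
  also have "sum g gap = 0"
  proof (cases "even n")
    case True
    then obtain c where c: "int n = 2 * c" by (metis dvdE even_of_nat_iff)
    then have "gap = {c - 1}" by (auto simp: gap_def)
    then show ?thesis
      using half_laplace_gap_two[of h "c + 1"] by (simp add: g_def c)
  next
    case False
    then obtain c where c: "int n = 2 * c + 1" by (metis oddE even_of_nat_iff)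
    then have "gap = {c, c - 1}" by (auto simp: gap_def)
    then show ?thesis
      using half_laplace_gap_one_three[of h "c + 1"] by (simp add: g_def c add.commute)
  qed
  finally show ?thesis
    by (simp add: g_def upper_def sum.distrib algebra_simps)
qed


section \<open>Passing to infinitely many variables\<close>

definition variable :: "nat \<Rightarrow> 'a::comm_ring_1 inf_fps" where
  "variable i = Abs_inf_fps (\<lambda>m. if m = {#i#} then 1 else 0)"

text \<open>Substituting 0 for all variables with index \<open>N\<close> or larger.\<close>

definition restrict_vars :: "nat \<Rightarrow> 'a::comm_ring_1 inf_fps \<Rightarrow> 'a inf_fps" where
  "restrict_vars N f = Abs_inf_fps (\<lambda>m. if set_mset m \<subseteq> {..<N} then inf_coeff f m else 0)"

lemma inf_coeff_restrict_vars:
  "inf_coeff (restrict_vars N f) m = (if set_mset m \<subseteq> {..<N} then inf_coeff f m else 0)"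
  by (simp add: restrict_vars_def)

lemma restrict_vars_eqI:
  assumes "\<And>N. restrict_vars N f = restrict_vars N g"
  shows "f = g"
proof (rule inf_fps_eqI)
  fix m :: "nat multiset"
  obtain N where "set_mset m \<subseteq> {..<N}"
    using finite_nat_iff_bounded[of "set_mset m"] by auto
  then show "inf_coeff f m = inf_coeff g m"
    using arg_cong[OF assms[of N], of "\<lambda>f. inf_coeff f m"] by (simp add: inf_coeff_restrict_vars)
qed

lemma restrict_vars_0: "restrict_vars N 0 = 0"
  and restrict_vars_add: "restrict_vars N (f + g) = restrict_vars N f + restrict_vars N g"
  and restrict_vars_diff: "restrict_vars N (f - g) = restrict_vars N f - restrict_vars N g"
  by (rule inf_fps_eqI; simp add: inf_coeff_restrict_vars)+

lemma restrict_vars_mult: "restrict_vars N (f * g) = restrict_vars N f * restrict_vars N g"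
proof (rule inf_fps_eqI)
  fix m
  show "inf_coeff (restrict_vars N (f * g)) m = inf_coeff (restrict_vars N f * restrict_vars N g) m"
  proof (cases "set_mset m \<subseteq> {..<N}")
    case True
    then show ?thesis
      unfolding inf_coeff_mult inf_coeff_restrict_vars by (auto intro!: sum.cong)
  next
    case False
    then have "inf_coeff (restrict_vars N f) u * inf_coeff (restrict_vars N g) v = 0" if "u + v = m" for u v
      using that by (auto simp: inf_coeff_restrict_vars)
    then have "inf_coeff (restrict_vars N f * restrict_vars N g) m = 0"
      unfolding inf_coeff_mult by (intro sum.neutral) auto
    with False show ?thesis by (simp add: inf_coeff_restrict_vars)
  qed
qed

lemma restrict_vars_sum: "restrict_vars N (sum f A) = (\<Sum>a\<in>A. restrict_vars N (f a))"
  by (induction A rule: infinite_finite_induct) (simp_all add: restrict_vars_0 restrict_vars_add)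

lemma inf_coeff_sum: "inf_coeff (sum f A) m = (\<Sum>a\<in>A. inf_coeff (f a) m)"
  by (induction A rule: infinite_finite_induct) simp_all

lemma inf_coeff_variable_mult:
  "inf_coeff (variable i * f) m = (if i \<in># m then inf_coeff f (m - {#i#}) else 0)"
proof -
  let ?P = "{(u, v). u + v = m}"
  have "inf_coeff (variable i * f) m =
      (\<Sum>(u, v)\<in>?P. if u = {#i#} then inf_coeff f v else 0)"
    unfolding inf_coeff_mult by (intro sum.cong) (auto simp: variable_def)
  also have "\<dots> = (\<Sum>(u, v)\<in>(if i \<in># m then {({#i#}, m - {#i#})} else {}). inf_coeff f v)"
    by (rule sum.mono_neutral_cong_right) (auto split: if_splits)
  finally show ?thesis by simp
qed

lemma inf_coeff_monomial:
  "inf_coeff (prod_list (map variable xs)) m = (if mset xs = m then 1 else 0)"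
proof (induction xs arbitrary: m)
  case (Cons i xs)
  have "add_mset i (mset xs) = m \<longleftrightarrow> i \<in># m \<and> mset xs = m - {#i#}" by auto
  with Cons show ?case by (simp add: inf_coeff_variable_mult)
qed (simp add: inf_coeff_1 eq_commute)

text \<open>
  Each tableau contributes the monomial of its entries, and that monomial survives the restriction if
  and only if all the entries are below \<open>N\<close>.
\<close>

lemma restrict_vars_schur: "restrict_vars N (schur \<mu>) = schur_poly variable N \<mu>"
proof (rule inf_fps_eqI)
  fix m
  have "inf_coeff (schur_poly variable N \<mu>) m =
      (\<Sum>T\<in>tableaux N \<mu>. if mset (concat T) = m then 1 else 0 :: rat)"
    by (simp add: schur_poly_def inf_coeff_sum inf_coeff_monomial)
  also have "\<dots> = of_nat (card {T \<in> tableaux N \<mu>. mset (concat T) = m})"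
    by (simp add: sum.If_cases finite_tableaux Int_def)
  also have "{T \<in> tableaux N \<mu>. mset (concat T) = m} =
      (if set_mset m \<subseteq> {..<N} then {T. semistandard T \<mu> \<and> mset (concat T) = m} else {})"
    by (auto simp: tableaux_def simp flip: set_mset_mset)
  also have "of_nat (card \<dots>) = inf_coeff (restrict_vars N (schur \<mu>)) m"
    by (simp add: inf_coeff_restrict_vars schur_def)
  finally show "inf_coeff (restrict_vars N (schur \<mu>)) m = inf_coeff (schur_poly variable N \<mu>) m" ..
qed

theorem theorem3p8:
  shows "fps_X * (two_row_series 0 * two_row_series 2 - (two_row_series 1)\<^sup>2)
           + (two_row_series 0)\<^sup>2
         = Abs_fps (\<lambda>n. \<Sum>(a, b) | b \<le> a \<and> a + b = n. schur [a, a, b, b])"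
    (is "?lhs = ?rhs")
proof (rule fps_ext, rule restrict_vars_eqI)
  fix n N
  define h :: "int \<Rightarrow> rat inf_fps" where "h = complete_poly variable N"
  have h_neg: "h k = 0" if "k < 0" for k
    using that by (simp add: h_def complete_poly_neg)
  have two_rows: "restrict_vars N (fps_nth (two_row_series i) k) = two_row_minor h (int k + int i) (int k)"
    for i k
    by (simp add: two_row_series_def restrict_vars_schur schur_poly_eq_det_jacobi_trudi_mat
        det_jacobi_trudi_mat_two_rows h_def)
  have four_rows: "restrict_vars N (schur [a, a, b, b]) =
      half_laplace h (int a) (int b) + half_laplace h (int b - 2) (int a + 2)" if "b \<le> a" for a b
    using that by (simp add: restrict_vars_schur schur_poly_eq_det_jacobi_trudi_mat
        det_jacobi_trudi_mat_four_rows h_def)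
  define A B C where "A = (\<lambda>k. two_row_minor h k k)" and "B = (\<lambda>k. two_row_minor h (k + 1) k)"
    and "C = (\<lambda>k. two_row_minor h (k + 2) k)"
  have half: "half_laplace h a b = A a * A b - B a * B (b - 1) + C a * A (b - 1)" for a b
    by (simp add: half_laplace_def A_def B_def C_def)
  have "restrict_vars N (fps_nth ?lhs n) =
      (\<Sum>i\<le>n. half_laplace h (int i) (int n - int i))"
  proof (cases n)
    case 0
    then show ?thesis
      by (simp add: half power2_eq_square fps_mult_nth restrict_vars_mult restrict_vars_add two_rows
          A_def B_def C_def two_row_minor_def h_neg)
  next
    case (Suc k)
    have "restrict_vars N (fps_nth ?lhs n) =
        (\<Sum>i\<le>k. A (int i) * C (int k - int i)) - (\<Sum>i\<le>k. B (int i) * B (int k - int i)) +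
        (\<Sum>i\<le>n. A (int i) * A (int n - int i))"
      unfolding Suc fps_add_nth fps_X_mult_nth
      by (simp add: power2_eq_square fps_mult_nth restrict_vars_mult restrict_vars_add restrict_vars_diff
          restrict_vars_sum two_rows A_def B_def C_def of_nat_diff atLeast0AtMost algebra_simps
          del: sum.atMost_Suc)
    \<comment> \<open>Both products have one term fewer than the square; the extra term \<open>i = n\<close> is zero, because
      \<open>A\<close> and \<open>B\<close> vanish at \<open>-1\<close>.\<close>
    also have "(\<Sum>i\<le>k. A (int i) * C (int k - int i)) = (\<Sum>i\<le>k. C (int i) * A (int k - int i))"
      by (rule sum.reindex_bij_witness[where i = "\<lambda>i. k - i" and j = "\<lambda>i. k - i"])
        (auto simp: of_nat_diff)
    also have "\<dots> = (\<Sum>i\<le>n. C (int i) * A (int n - int i - 1))"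
      by (simp add: Suc A_def two_row_minor_def h_neg)
    also have "(\<Sum>i\<le>k. B (int i) * B (int k - int i)) = (\<Sum>i\<le>n. B (int i) * B (int n - int i - 1))"
      by (simp add: Suc B_def two_row_minor_def h_neg)
    finally show ?thesis
      by (simp add: half sum.distrib sum_subtractf)
  qed
  also have "\<dots> = (\<Sum>a\<in>{0..int n}. half_laplace h a (int n - a))"
    by (rule sum.reindex_bij_witness[where i = nat and j = int]) auto
  also have "\<dots> = (\<Sum>a\<in>{a. int n \<le> 2 * a \<and> a \<le> int n}.
       half_laplace h a (int n - a) + half_laplace h (int n - a - 2) (a + 2))"
    by (rule sum_half_laplace) (rule h_neg)
  also have "\<dots> = (\<Sum>(a, b) | b \<le> a \<and> a + b = n. restrict_vars N (schur [a, a, b, b]))"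
    by (rule sum.reindex_bij_witness[where i = "\<lambda>(a, b). int a"
          and j = "\<lambda>a. (nat a, nat (int n - a))"])
      (auto simp: four_rows)
  also have "\<dots> = restrict_vars N (fps_nth ?rhs n)"
    by (simp add: restrict_vars_sum case_prod_beta)
  finally show "restrict_vars N (fps_nth ?lhs n) = restrict_vars N (fps_nth ?rhs n)" .
qed

end
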